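(* Let $k\ge 1$. Let $\nu(m,r,s,u)$ be the formal power series in $r$ satisfying $$f(rs)\,\nu(m,r,s,u)=1-g(rs)\prod_{j=0}^{k}\nu(m,rs^{j},s,u),$$ where $f(x)=1+x(m-1)$ and $g(x)=x(m(u-1)+1)$. Then $$\nu(m,r,s,u)=\sum_{n\ge 0}(-rs)^{n}\sum_{\mu\in\mathtt{Dyck}(n;k)}s^{|Y(\mu_{0}/\mu)|}\,\mathrm{wt}^{I}(k;\mu).$$
   Context: $m,s,u$ are formal variables, $m'=m-1$, $u'=u-1$, and power series in $r$ have coefficients in $\mathbb{Z}[m,s,u]$. A $k$-Dyck path of size $n$ is a lattice path from $(0,0)$ to $(kn,n)$ consisting of up steps $U=(0,1)$ and down steps $D=(1,0)$ which never goes below the line $y=x/k$; $\mathtt{Dyck}(n;k)$ is the set of them. $\mu_0=(UD^k)^n$ is the lowest path, and $|Y(\mu_0/\mu)|$ is the number of unit boxes above $\mu_0$ and below $\mu$. $\mathrm{Peak}(k;\mu)$ is the number of occurrences of the pattern $UD^{k}$ (consecutive steps) in $\mu$. For $\mu\in\mathtt{Dyck}(n;k)$, $$\mathrm{wt}^{I}(k;\mu)=(m'+1)^{\mathrm{Peak}(k;\mu)}(u'+1)^{\mathrm{Peak}(k;\mu)}(m'u'+u'+1)^{n-\mathrm{Peak}(k;\mu)}.$$ *)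

theory Defs
  imports "HOL-Computational_Algebra.Computational_Algebra"
begin

section \<open>The coefficient ring\<close>

text \<open>The ring of integer polynomials in \<open>m, s, u\<close> is realised as the iterated polynomial ring
  with innermost variable \<open>m\<close> and outermost variable \<open>u\<close>.\<close>

type_synonym coef = "int poly poly poly"

definition m_var :: coef where "m_var = [:[:[:0, 1:]:]:]"
definition s_var :: coef where "s_var = [:[:0, 1:]:]"
definition u_var :: coef where "u_var = [:0, 1:]"

definition m_prime :: coef where "m_prime = m_var - 1"
definition u_prime :: coef where "u_prime = u_var - 1"

section \<open>Lattice paths\<close>

datatype step = U | D

type_synonym path = "step list"

text \<open>Coordinates of the lattice point reached after the first \<open>i\<close> steps.\<close>

definition xpos :: "path \<Rightarrow> nat \<Rightarrow> nat" where
  "xpos \<mu> i = count_list (take i \<mu>) D"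

definition ypos :: "path \<Rightarrow> nat \<Rightarrow> nat" where
  "ypos \<mu> i = count_list (take i \<mu>) U"

text \<open>The condition \<open>y \<ge> x / k\<close> is written without division; it suffices to impose it at the lattice
  points of the path, since a half-plane is convex.\<close>

definition Dyck :: "nat \<Rightarrow> nat \<Rightarrow> path set" where
  "Dyck n k = {\<mu>. xpos \<mu> (length \<mu>) = k * n \<and> ypos \<mu> (length \<mu>) = n \<and>
                  (\<forall>i\<le>length \<mu>. xpos \<mu> i \<le> k * ypos \<mu> i)}"

definition lowest_path :: "nat \<Rightarrow> nat \<Rightarrow> path" where
  "lowest_path n k = concat (replicate n (U # replicate k D))"

text \<open>The pair \<open>(a, b)\<close> stands for the unit box with lower left corner \<open>(a, b)\<close> and upper right
  corner \<open>(a + 1, b + 1)\<close>.  Its position relative to a path is decided by the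
  horizontal step of the path from abscissa \<open>a\<close> to abscissa \<open>a + 1\<close>.\<close>

definition boxes_below :: "path \<Rightarrow> (nat \<times> nat) set" where
  "boxes_below \<mu> =
     {(a, b). \<exists>i<length \<mu>. \<mu> ! i = D \<and> xpos \<mu> i = a \<and> b + 1 \<le> ypos \<mu> i}"

definition boxes_above :: "path \<Rightarrow> (nat \<times> nat) set" where
  "boxes_above \<mu> =
     {(a, b). \<exists>i<length \<mu>. \<mu> ! i = D \<and> xpos \<mu> i = a \<and> ypos \<mu> i \<le> b}"

definition Y_boxes :: "path \<Rightarrow> path \<Rightarrow> (nat \<times> nat) set" where
  "Y_boxes \<mu>0 \<mu> = boxes_above \<mu>0 \<inter> boxes_below \<mu>"

definition Peak :: "nat \<Rightarrow> path \<Rightarrow> nat" where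
  "Peak k \<mu> = card {i. take (Suc k) (drop i \<mu>) = U # replicate k D}"

text \<open>The weight of a path in \<open>Dyck n k\<close>.  Such a path has \<open>n\<close> up steps, so \<open>Peak k \<mu> \<le> n\<close> and the
  subtraction in the exponent is not truncated.\<close>

definition wtI :: "nat \<Rightarrow> nat \<Rightarrow> path \<Rightarrow> coef" where
  "wtI n k \<mu> = (m_prime + 1) ^ Peak k \<mu> * (u_prime + 1) ^ Peak k \<mu> *
                (m_prime * u_prime + u_prime + 1) ^ (n - Peak k \<mu>)"

section \<open>The functional equation\<close>

text \<open>Power series in \<open>r\<close> are elements of \<open>coef fps\<close>, with \<open>r\<close> being \<open>fps_X\<close>.\<close>

definition f_fun :: "coef fps \<Rightarrow> coef fps" where
  "f_fun x = 1 + x * fps_const (m_var - 1)"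

definition g_fun :: "coef fps \<Rightarrow> coef fps" where
  "g_fun x = x * fps_const (m_var * (u_var - 1) + 1)"

definition nu_equation :: "nat \<Rightarrow> coef fps \<Rightarrow> bool" where
  "nu_equation k \<nu> \<longleftrightarrow>
     f_fun (fps_X * fps_const s_var) * \<nu> =
       1 - g_fun (fps_X * fps_const s_var) *
           (\<Prod>j=0..k. \<nu> oo (fps_X * fps_const (s_var ^ j)))"

section \<open>Finiteness\<close>

text \<open>The sums and cardinalities over the sets below are therefore the intended ones.\<close>

lemma length_path: "length (\<mu>::path) = count_list \<mu> D + count_list \<mu> U"
proof (induction \<mu>)
  case (Cons a \<mu>)
  then show ?case by (cases a) auto
qed simp

lemma finite_Dyck: "finite (Dyck n k)"
proof (rule finite_subset)
  have "(UNIV :: step set) \<subseteq> {U, D}"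
    using step.exhaust by auto
  then have "finite (UNIV :: step set)"
    by (rule finite_subset) simp
  then show "finite {\<mu>. set \<mu> \<subseteq> (UNIV :: step set) \<and> length \<mu> = k * n + n}"
    by (rule finite_lists_length_eq)
  show "Dyck n k \<subseteq> {\<mu>. set \<mu> \<subseteq> (UNIV :: step set) \<and> length \<mu> = k * n + n}"
    by (auto simp: Dyck_def xpos_def ypos_def length_path)
qed

lemma finite_Y_boxes: "finite (Y_boxes \<mu>0 \<mu>)"
proof (rule finite_subset)
  have "xpos \<mu> i \<le> length \<mu>" "ypos \<mu> i \<le> length \<mu>" for i
    using length_path[of "take i \<mu>"] by (auto simp: xpos_def ypos_def)
  then show "Y_boxes \<mu>0 \<mu> \<subseteq> {..length \<mu>} \<times> {..length \<mu>}"
    by (fastforce simp: Y_boxes_def boxes_below_def dest: le_trans)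
qed simp

lemma finite_Peak_positions: "finite {i. take (Suc k) (drop i \<mu>) = U # replicate k D}"
proof (rule finite_subset)
  show "{i. take (Suc k) (drop i \<mu>) = U # replicate k D} \<subseteq> {..length \<mu>}"
    by (auto intro: leI simp: not_le[symmetric])
qed simp

end

theory Submission imports Defs begin

text \<open>Call \<open>k y - x\<close> the level of the point \<open>(x, y)\<close>, and let \<open>W\<^sub>j\<close> be the generating function in \<open>- r s\<close> of the
  paths which start at level \<open>j\<close>, stay at levels \<open>\<ge> 0\<close> and end at level \<open>0\<close>.  Counting boxes by rows,
  every up step contributes its starting level to the area.  Removing the first step gives
  \[W_j = W_{j-1} - r s^{j+1} (c\, W_{j+k} + (p - c) W_j), \qquad W_{-1} = 1,\]
  where \<open>p = m u\<close> is the weight of an up step opening a peak and \<open>c = m (u - 1) + 1\<close> that of any other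
  up step; the correction term \<open>(p - c) W\<^sub>j\<close> comes from the paths beginning with \<open>U D\<^sup>k\<close>.
  If \<open>\<nu>\<close> solves the functional equation, the products \<open>\<nu>(r) \<nu>(r s) \<cdots> \<nu>(r s\<^sup>j)\<close> satisfy the same
  recurrence, which has only one solution; so they are equal to \<open>W\<^sub>j\<close>, and \<open>j = 0\<close> is the claim.\<close>

section \<open>Contractive operators on power series\<close>

text \<open>Coefficient \<open>n\<close> of \<open>\<Phi> F\<close> depends only on the coefficients
  of \<open>F\<close> below \<open>n\<close>. Hence the iterates of \<open>\<Phi>\<close> from
  \<open>0\<close> stabilise coefficient by coefficient, and two fixpoints agree by strong
  induction.\<close>

lemma fps_contraction_fixpoint:
  fixes \<Phi> :: "'a::zero fps \<Rightarrow> 'a fps"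
  assumes contr: "\<And>F G n. (\<And>i. i < n \<Longrightarrow> fps_nth F i = fps_nth G i) \<Longrightarrow>
                     fps_nth (\<Phi> F) n = fps_nth (\<Phi> G) n"
  shows "\<exists>!F. F = \<Phi> F"
proof (rule ex_ex1I)
  define T where "T N = (\<Phi> ^^ N) 0" for N
  have T_Suc: "T (Suc N) = \<Phi> (T N)" for N
    by (simp add: T_def)
  have step: "\<forall>i<N. fps_nth (T (Suc N)) i = fps_nth (T N) i" for N
  proof (induction N)
    case (Suc N)
    show ?case
    proof (intro allI impI)
      fix i assume "i < Suc N"
      with Suc have "fps_nth (\<Phi> (T (Suc N))) i = fps_nth (\<Phi> (T N)) i"
        by (intro contr) auto
      then show "fps_nth (T (Suc (Suc N))) i = fps_nth (T (Suc N)) i"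
        by (simp add: T_Suc)
    qed
  qed simp
  have stable: "fps_nth (T N) i = fps_nth (T (Suc i)) i" if "i < N" for i N
  proof -
    have "Suc i \<le> N" using that by simp
    then show ?thesis
      by (induction N rule: dec_induct) (use step in auto)
  qed
  define F where "F = Abs_fps (\<lambda>n. fps_nth (T (Suc n)) n)"
  have "F = \<Phi> F"
  proof (rule fps_ext)
    fix n
    have "fps_nth (\<Phi> F) n = fps_nth (\<Phi> (T n)) n"
      by (rule contr) (unfold F_def fps_nth_Abs_fps, rule stable[symmetric])
    then show "fps_nth F n = fps_nth (\<Phi> F) n"
      by (simp only: F_def fps_nth_Abs_fps T_Suc)
  qed
  then show "\<exists>F. F = \<Phi> F" by blast
next
  fix F G assume FG: "F = \<Phi> F" "G = \<Phi> G"
  have "fps_nth F n = fps_nth G n" for n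
  proof (induction n rule: less_induct)
    case (less n)
    then show ?case using contr[of n F G] FG by simp
  qed
  then show "F = G" by (rule fps_ext)
qed

lemma fps_nth_prod_cong:
  fixes f g :: "'i \<Rightarrow> 'a::comm_ring_1 fps"
  assumes "\<And>x i. x \<in> A \<Longrightarrow> i \<le> n \<Longrightarrow> fps_nth (f x) i = fps_nth (g x) i" and "l \<le> n"
  shows "fps_nth (prod f A) l = fps_nth (prod g A) l"
  using assms
proof (induction A arbitrary: l rule: infinite_finite_induct)
  case (insert a A)
  then show ?case
    by (auto simp: fps_mult_nth intro!: sum.cong arg_cong2[of _ _ _ _ "(*)"])
qed auto

lemma fps_nth_compose_scaled_X:
  "fps_nth (F oo (fps_X * fps_const c)) n = c ^ n * fps_nth F n"
  for F :: "'a::comm_ring_1 fps"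
  by (subst mult.commute, subst fps_compose_linear) simp

lemma fps_compose_scaled_X_scaled_X:
  "(F oo (fps_X * fps_const a)) oo (fps_X * fps_const b) = F oo (fps_X * fps_const (a * b))"
  for F :: "'a::comm_ring_1 fps"
  by (rule fps_ext) (simp add: fps_nth_compose_scaled_X power_mult_distrib mult_ac)

section \<open>Paths from a given level\<close>

fun stays_above :: "nat \<Rightarrow> nat \<Rightarrow> path \<Rightarrow> bool" where
  "stays_above k j [] \<longleftrightarrow> j = 0"
| "stays_above k j (U # \<mu>) \<longleftrightarrow> stays_above k (j + k) \<mu>"
| "stays_above k j (D # \<mu>) \<longleftrightarrow> j > 0 \<and> stays_above k (j - 1) \<mu>"

text \<open>In row \<open>y\<close> the boxes counted lie right of the up step from
  \<open>(x, y)\<close> and left of abscissa \<open>k * y\<close>, where the lowest path rises;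
  their number is the level \<open>k * y - x\<close>.\<close>

fun row_area :: "nat \<Rightarrow> nat \<Rightarrow> path \<Rightarrow> nat" where
  "row_area k j [] = 0"
| "row_area k j (U # \<mu>) = j + row_area k (j + k) \<mu>"
| "row_area k j (D # \<mu>) = row_area k (j - 1) \<mu>"

definition level_paths :: "nat \<Rightarrow> nat \<Rightarrow> nat \<Rightarrow> path set" where
  "level_paths k j n = {\<mu>. stays_above k j \<mu> \<and> count_list \<mu> U = n}"

lemma stays_above_count_D: "stays_above k j \<mu> \<Longrightarrow> count_list \<mu> D = j + k * count_list \<mu> U"
  by (induction k j \<mu> rule: stays_above.induct) auto

lemma finite_level_paths: "finite (level_paths k j n)"
proof (rule finite_subset)
  show "level_paths k j n \<subseteq> {\<mu>. set \<mu> \<subseteq> {U, D} \<and> length \<mu> = j + k * n + n}"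
    by (auto simp: level_paths_def length_path stays_above_count_D) (metis step.exhaust)
  show "finite {\<mu>. set \<mu> \<subseteq> {U, D} \<and> length \<mu> = j + k * n + n}"
    by (rule finite_lists_length_eq) simp
qed

lemma stays_above_iff:
  "stays_above k j \<mu> \<longleftrightarrow> count_list \<mu> D = j + k * count_list \<mu> U \<and>
     (\<forall>i\<le>length \<mu>. xpos \<mu> i \<le> j + k * ypos \<mu> i)"
proof (induction k j \<mu> rule: stays_above.induct)
  case (1 k j)
  then show ?case by (auto simp: xpos_def ypos_def)
next
  case (2 k j \<mu>)
  have "(\<forall>i\<le>length (U # \<mu>). xpos (U # \<mu>) i \<le> j + k * ypos (U # \<mu>) i) \<longleftrightarrow>
        (\<forall>i\<le>length \<mu>. xpos \<mu> i \<le> j + k + k * ypos \<mu> i)"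
    unfolding length_Cons less_Suc_eq_le[symmetric] All_less_Suc2[of "Suc (length \<mu>)"]
    by (auto simp: xpos_def ypos_def)
  with 2 show ?case by auto
next
  case (3 k j \<mu>)
  have "(\<forall>i\<le>length (D # \<mu>). xpos (D # \<mu>) i \<le> j + k * ypos (D # \<mu>) i) \<longleftrightarrow>
        (\<forall>i\<le>length \<mu>. Suc (xpos \<mu> i) \<le> j + k * ypos \<mu> i)"
    unfolding length_Cons less_Suc_eq_le[symmetric] All_less_Suc2[of "Suc (length \<mu>)"]
    by (auto simp: xpos_def ypos_def)
  moreover have "j > 0" if "\<forall>i\<le>length \<mu>. Suc (xpos \<mu> i) \<le> j + k * ypos \<mu> i"
    using that[rule_format, of 0] by (simp add: xpos_def ypos_def)
  ultimately show ?case using 3 by (cases j) auto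
qed

lemma Dyck_eq_level_paths: "Dyck n k = level_paths k 0 n"
  by (auto simp: Dyck_def level_paths_def stays_above_iff) (auto simp: xpos_def ypos_def)

lemma stays_above_replicate_D:
  "stays_above k (j + l) (replicate l D @ \<mu>) \<longleftrightarrow> stays_above k j \<mu>"
  by (induction l) auto

section \<open>The area as a sum of levels\<close>

text \<open>The pairs \<open>(a, h)\<close> such that the path, started at \<open>(x, y)\<close>, has a down step from \<open>(a, h)\<close>
  to \<open>(a + 1, h)\<close>.\<close>

fun down_steps :: "nat \<Rightarrow> nat \<Rightarrow> path \<Rightarrow> (nat \<times> nat) set" where
  "down_steps x y [] = {}"
| "down_steps x y (U # \<mu>) = down_steps x (Suc y) \<mu>"
| "down_steps x y (D # \<mu>) = insert (x, y) (down_steps (Suc x) y \<mu>)"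

lemma mem_down_steps_iff:
  "(a, h) \<in> down_steps x y \<mu> \<longleftrightarrow>
     (\<exists>i<length \<mu>. \<mu> ! i = D \<and> a = x + xpos \<mu> i \<and> h = y + ypos \<mu> i)"
  by (induction x y \<mu> rule: down_steps.induct)
    (auto simp: xpos_def ypos_def Ex_less_Suc2)

lemma down_steps_abscissa: "(a, h) \<in> down_steps x y \<mu> \<Longrightarrow> x \<le> a \<and> a < x + count_list \<mu> D"
  by (induction x y \<mu> rule: down_steps.induct) fastforce+

lemma finite_down_steps: "finite (down_steps x y \<mu>)"
  by (induction x y \<mu> rule: down_steps.induct) auto

lemma down_steps_replicate_D:
  "down_steps x y (replicate l D @ \<mu>) = {x..<x + l} \<times> {y} \<union> down_steps (x + l) y \<mu>"
  by (induction l arbitrary: x) (auto simp: le_less_Suc_eq)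

text \<open>The block \<open>U D^k\<close> from \<open>(k * y, y)\<close> covers the columns
  \<open>k * y \<le> a < k * Suc y\<close> at height \<open>Suc y\<close>, and for these
  \<open>Suc y \<le> b\<close> iff \<open>a < k * b\<close>. The start \<open>y\<close> varies for
  the induction on \<open>n\<close>.\<close>

lemma down_steps_lowest_path:
  "(\<exists>h\<le>b. (a, h) \<in> down_steps (k * y) y (lowest_path n k)) \<longleftrightarrow>
     k * y \<le> a \<and> a < k * (y + n) \<and> a < k * b"
proof (induction n arbitrary: y)
  case 0
  then show ?case by (simp add: lowest_path_def)
next
  case (Suc n)
  have path: "lowest_path (Suc n) k = U # replicate k D @ lowest_path n k"
    by (simp add: lowest_path_def)
  have lt: "a < k * b \<longleftrightarrow> Suc y \<le> b" if "k * y \<le> a" "a < k * Suc y"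
  proof
    assume "a < k * b"
    with that(1) have "k * y < k * b" by linarith
    then show "Suc y \<le> b" by simp
  next
    assume "Suc y \<le> b"
    then have "k * Suc y \<le> k * b" by (rule mult_le_mono2)
    with that(2) show "a < k * b" by linarith
  qed
  have shift: "k * y + k = k * Suc y" "k * (y + Suc n) = k * (Suc y + n)" "k * Suc y \<le> k * (Suc y + n)"
    by (auto simp: algebra_simps)
  have "(\<exists>h\<le>b. (a, h) \<in> down_steps (k * y) y (lowest_path (Suc n) k)) \<longleftrightarrow>
        (k * y \<le> a \<and> a < k * Suc y \<and> Suc y \<le> b) \<or>
        (\<exists>h\<le>b. (a, h) \<in> down_steps (k * Suc y) (Suc y) (lowest_path n k))"
    unfolding path down_steps.simps down_steps_replicate_D shift(1) by auto
  also have "\<dots> \<longleftrightarrow> k * y \<le> a \<and> a < k * (y + Suc n) \<and> a < k * b"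
  proof -
    have glue: "(z \<le> a \<and> a < w \<and> Q) \<or> (w \<le> a \<and> a < v \<and> P) \<longleftrightarrow> z \<le> a \<and> a < v \<and> P"
      if "z \<le> w" "w \<le> v" "z \<le> a \<Longrightarrow> a < w \<Longrightarrow> P \<longleftrightarrow> Q" for z w v P Q
      using that by auto
    show ?thesis
      unfolding Suc.IH shift(2) by (rule glue[OF _ shift(3) lt]) simp
  qed
  finally show ?case .
qed

text \<open>The boxes are collected by columns, and \<open>row_area\<close> by rows.  When the path has reached \<open>(x, y)\<close>,
  the sum on the right counts the boxes of the first \<open>y\<close> rows in columns not yet passed.\<close>

lemma card_boxes_eq_row_area:
  assumes "stays_above k j \<mu>" "x + j = k * y"
  shows "card {(a, b). \<exists>h. (a, h) \<in> down_steps x y \<mu> \<and> a < k * b \<and> b < h} =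
           row_area k j \<mu> + (\<Sum>b<y. k * b - x)"
  using assms
proof (induction k j \<mu> arbitrary: x y rule: stays_above.induct)
  case (1 k j)
  \<comment> \<open>Here \<open>j = 0\<close>, so \<open>x = k * y\<close> and every difference with
    \<open>b < y\<close> is truncated to \<open>0\<close>.\<close>
  have "(\<Sum>b<y. k * b - x) = 0"
    using 1 by simp
  then show ?case by simp
next
  case (2 k j \<mu>)
  \<comment> \<open>Raising \<open>y\<close> adds the summand \<open>b = y\<close>, which is
    \<open>k * y - x = j\<close>, the amount \<open>row_area\<close> gains.\<close>
  then show ?case by auto
next
  case (3 k j \<mu>)
  let ?B = "\<lambda>x \<mu>. {(a, b). \<exists>h. (a, h) \<in> down_steps x y \<mu> \<and> a < k * b \<and> b < h}"
  have split: "?B x (D # \<mu>) = Pair x ` {b. x < k * b \<and> b < y} \<union> ?B (Suc x) \<mu>"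
    by auto
  have disj: "Pair x ` {b. x < k * b \<and> b < y} \<inter> ?B (Suc x) \<mu> = {}"
    by (auto dest: down_steps_abscissa)
  have "?B (Suc x) \<mu> \<subseteq> (\<Union>(a, h)\<in>down_steps (Suc x) y \<mu>. {a} \<times> {..<h})"
    by auto
  then have fin: "finite (?B (Suc x) \<mu>)"
    by (rule finite_subset) (auto intro: finite_down_steps)
  have "card (?B x (D # \<mu>)) = card {b. x < k * b \<and> b < y} + card (?B (Suc x) \<mu>)"
    unfolding split by (subst card_Un_disjoint[OF _ fin disj]) (auto simp: card_image inj_on_def)
  also have "card (?B (Suc x) \<mu>) = row_area k (j - 1) \<mu> + (\<Sum>b<y. k * b - Suc x)"
    using 3 by auto
  also have "card {b. x < k * b \<and> b < y} = (\<Sum>b<y. if x < k * b then 1 else 0)"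
    by (subst sum.inter_filter[symmetric]) (auto intro!: arg_cong[of _ _ card])
  also have "\<dots> + (row_area k (j - 1) \<mu> + (\<Sum>b<y. k * b - Suc x)) =
             row_area k (j - 1) \<mu> + (\<Sum>b<y. (if x < k * b then 1 else 0) + (k * b - Suc x))"
    by (simp add: sum.distrib)
  \<comment> \<open>Passing column \<open>x\<close> lowers \<open>k * b - x\<close> by one exactly
    when \<open>x < k * b\<close>.\<close>
  also have "(\<Sum>b<y. (if x < k * b then 1 else 0) + (k * b - Suc x)) = (\<Sum>b<y. k * b - x)"
    by (rule sum.cong) auto
  finally show ?case by simp
qed

lemma card_Y_boxes:
  assumes "\<mu> \<in> level_paths k 0 n"
  shows "card (Y_boxes (lowest_path n k) \<mu>) = row_area k 0 \<mu>"
proof -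
  have \<mu>: "stays_above k 0 \<mu>" "count_list \<mu> D = k * n"
    using assms stays_above_count_D by (auto simp: level_paths_def)
  have above: "boxes_above (lowest_path n k) = {(a, b). a < k * n \<and> a < k * b}"
  proof -
    have "boxes_above (lowest_path n k) = {(a, b). \<exists>h\<le>b. (a, h) \<in> down_steps 0 0 (lowest_path n k)}"
      by (auto simp: boxes_above_def mem_down_steps_iff)
    then show ?thesis
      using down_steps_lowest_path[of _ _ k 0 n] by simp
  qed
  have below: "boxes_below \<mu> = {(a, b). \<exists>h. (a, h) \<in> down_steps 0 0 \<mu> \<and> b < h}"
    by (force simp: boxes_below_def mem_down_steps_iff)
  have "Y_boxes (lowest_path n k) \<mu> =
        {(a, b). \<exists>h. (a, h) \<in> down_steps 0 0 \<mu> \<and> a < k * b \<and> b < h}"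
    unfolding Y_boxes_def above below using down_steps_abscissa[of _ _ 0 0 \<mu>] \<mu>(2) by fastforce
  then show ?thesis
    using card_boxes_eq_row_area[OF \<mu>(1), of 0 0] by simp
qed

section \<open>Weights\<close>

fun path_weight :: "nat \<Rightarrow> 'a::comm_ring_1 \<Rightarrow> 'a \<Rightarrow> path \<Rightarrow> 'a" where
  "path_weight k p c [] = 1"
| "path_weight k p c (U # \<mu>) = (if take k \<mu> = replicate k D then p else c) * path_weight k p c \<mu>"
| "path_weight k p c (D # \<mu>) = path_weight k p c \<mu>"

lemma Peak_Nil: "Peak k [] = 0"
  by (simp add: Peak_def)

lemma Peak_Cons:
  "Peak k (x # \<mu>) = (if x = U \<and> take k \<mu> = replicate k D then 1 else 0) + Peak k \<mu>"
proof -
  let ?A = "{i. take (Suc k) (drop i \<mu>) = U # replicate k D}"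
  have "{i. take (Suc k) (drop i (x # \<mu>)) = U # replicate k D} =
        (if x = U \<and> take k \<mu> = replicate k D then {0} else {}) \<union> Suc ` ?A" (is "?L = ?R")
  proof (rule set_eqI)
    fix i show "i \<in> ?L \<longleftrightarrow> i \<in> ?R" by (cases i) auto
  qed
  then show ?thesis
    using finite_Peak_positions[of k \<mu>] by (auto simp: Peak_def card_image)
qed

lemma Peak_le_count_U: "Peak k \<mu> \<le> count_list \<mu> U"
  by (induction \<mu>) (auto simp: Peak_Nil Peak_Cons)

lemma path_weight_eq_powers:
  "path_weight k p c \<mu> = p ^ Peak k \<mu> * c ^ (count_list \<mu> U - Peak k \<mu>)"
  by (induction k p c \<mu> rule: path_weight.induct)
    (auto simp: Peak_Nil Peak_Cons Suc_diff_le Peak_le_count_U)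

lemma path_weight_replicate_D: "path_weight k p c (replicate l D @ \<mu>) = path_weight k p c \<mu>"
  by (induction l) auto

lemma row_area_replicate_D: "row_area k (j + l) (replicate l D @ \<mu>) = row_area k j \<mu>"
  by (induction l) auto

section \<open>The recurrence in the starting level\<close>

context
  fixes k :: nat and s p c :: "'a::idom"
begin

definition level_sum :: "nat \<Rightarrow> nat \<Rightarrow> 'a" where
  "level_sum j n = (\<Sum>\<mu>\<in>level_paths k j n. s ^ row_area k j \<mu> * path_weight k p c \<mu>)"

text \<open>This is \<open>W\<^sub>j\<close> as a series in \<open>r\<close>; the factor
  \<open>(- s) ^ n\<close> comes from the powers of \<open>- r s\<close>.\<close>

definition level_gf :: "nat \<Rightarrow> 'a fps" where
  "level_gf j = Abs_fps (\<lambda>n. (- s) ^ n * level_sum j n)"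

text \<open>Deleting the initial \<open>D^k\<close> is a bijection onto the paths from level
  \<open>j\<close>; it preserves area and weight, as both are collected at up steps only.\<close>

lemma sum_peak_first:
  "(\<Sum>\<mu>\<in>{\<mu>\<in>level_paths k (j + k) n. take k \<mu> = replicate k D}.
      s ^ row_area k (j + k) \<mu> * path_weight k p c \<mu>) = level_sum j n"
  unfolding level_sum_def
proof (rule sum.reindex_bij_witness[of _ "\<lambda>\<mu>. replicate k D @ \<mu>" "drop k"])
  fix \<mu> assume "\<mu> \<in> {\<mu> \<in> level_paths k (j + k) n. take k \<mu> = replicate k D}"
  then have "\<mu> = replicate k D @ drop k \<mu>" "\<mu> \<in> level_paths k (j + k) n"
    by (metis (mono_tags) append_take_drop_id mem_Collect_eq)+
  then obtain \<mu>' where \<mu>': "\<mu> = replicate k D @ \<mu>'" "\<mu> \<in> level_paths k (j + k) n"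
    by blast
  then show "replicate k D @ drop k \<mu> = \<mu>" "drop k \<mu> \<in> level_paths k j n"
    "s ^ row_area k j (drop k \<mu>) * path_weight k p c (drop k \<mu>) =
     s ^ row_area k (j + k) \<mu> * path_weight k p c \<mu>"
    by (auto simp: level_paths_def stays_above_replicate_D row_area_replicate_D
        path_weight_replicate_D)
qed (auto simp: level_paths_def stays_above_replicate_D)

text \<open>The first up step adds \<open>j\<close> to the area and has weight \<open>c\<close>,
  plus \<open>p - c\<close> if \<open>D^k\<close> follows. The extra term is thus a sum over paths
  beginning with \<open>D^k\<close>, evaluated by \<open>sum_peak_first\<close>.\<close>

lemma sum_up_first:
  "(\<Sum>\<mu>\<in>Cons U ` level_paths k (j + k) n. s ^ row_area k j \<mu> * path_weight k p c \<mu>) =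
     s ^ j * (c * level_sum (j + k) n + (p - c) * level_sum j n)"
proof -
  let ?w = "\<lambda>\<mu>. s ^ row_area k (j + k) \<mu> * path_weight k p c \<mu>"
  have "(\<Sum>\<mu>\<in>Cons U ` level_paths k (j + k) n. s ^ row_area k j \<mu> * path_weight k p c \<mu>) =
        (\<Sum>\<mu>\<in>level_paths k (j + k) n.
           s ^ j * (c * ?w \<mu> + (p - c) * (if take k \<mu> = replicate k D then ?w \<mu> else 0)))"
    by (subst sum.reindex) (auto intro!: sum.cong simp: power_add algebra_simps)
  also have "\<dots> = s ^ j * (c * level_sum (j + k) n +
      (p - c) * (\<Sum>\<mu>\<in>{\<mu>\<in>level_paths k (j + k) n. take k \<mu> = replicate k D}. ?w \<mu>))"
    by (simp add: sum_distrib_left[symmetric] sum.distrib level_sum_def finite_level_paths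
        sum.inter_filter)
  finally show ?thesis by (simp add: sum_peak_first)
qed

lemma level_paths_unfold:
  "level_paths k j n =
     (if j = 0 \<and> n = 0 then {[]} else {}) \<union>
     (if j = 0 then {} else Cons D ` level_paths k (j - 1) n) \<union>
     (if n = 0 then {} else Cons U ` level_paths k (j + k) (n - 1))" (is "?L = ?R")
proof (rule set_eqI)
  fix \<mu> show "\<mu> \<in> ?L \<longleftrightarrow> \<mu> \<in> ?R"
    by (cases "(k, j, \<mu>)" rule: stays_above.cases)
      (auto simp: level_paths_def image_iff)
qed

text \<open>The paths are split by their first step. At level \<open>0\<close> a down step is
  impossible and the empty path takes its place; this is the convention
  \<open>W_{-1} = 1\<close>.\<close>

lemma level_sum_rec:
  "level_sum j n =
     (if j = 0 then of_bool (n = 0) else level_sum (j - 1) n) +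
     (if n = 0 then 0 else
        s ^ j * (c * level_sum (j + k) (n - 1) + (p - c) * level_sum j (n - 1)))"
proof -
  let ?w = "\<lambda>\<mu>. s ^ row_area k j \<mu> * path_weight k p c \<mu>"
  let ?E = "if j = 0 \<and> n = 0 then {[]} else {}"
  let ?D = "if j = 0 then {} else Cons D ` level_paths k (j - 1) n"
  let ?U = "if n = 0 then {} else Cons U ` level_paths k (j + k) (n - 1)"
  have fin: "finite ?E" "finite ?D" "finite ?U"
    by (auto simp: finite_level_paths)
  have "level_sum j n = sum ?w (?E \<union> ?D \<union> ?U)"
    unfolding level_sum_def level_paths_unfold[symmetric] ..
  also have "\<dots> = sum ?w ?E + sum ?w ?D + sum ?w ?U"
    using fin by (subst sum.union_disjoint; (subst sum.union_disjoint)?) auto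
  also have "sum ?w ?D = (if j = 0 then 0 else level_sum (j - 1) n)"
    by (auto simp: sum.reindex level_sum_def)
  also have "sum ?w ?U = (if n = 0 then 0 else
        s ^ j * (c * level_sum (j + k) (n - 1) + (p - c) * level_sum j (n - 1)))"
    using sum_up_first by simp
  also have "sum ?w ?E = (if j = 0 then of_bool (n = 0) else 0)"
    by simp
  finally show ?thesis by simp
qed

text \<open>In \<open>s ^ Suc j\<close>, the part \<open>s ^ j\<close> is the area of the first up
  step; the remaining \<open>s\<close> comes, with \<open>fps_X\<close> and the sign, from
  \<open>- r s\<close>.\<close>

lemma level_gf_rec:
  "level_gf j = (if j = 0 then 1 else level_gf (j - 1)) -
     fps_X * fps_const (s ^ Suc j) * (fps_const c * level_gf (j + k) + fps_const (p - c) * level_gf j)"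
proof (rule fps_ext)
  fix n
  show "fps_nth (level_gf j) n = fps_nth ((if j = 0 then 1 else level_gf (j - 1)) -
     fps_X * fps_const (s ^ Suc j) * (fps_const c * level_gf (j + k) + fps_const (p - c) * level_gf j)) n"
    unfolding mult.assoc
    by (cases n) (auto simp: level_gf_def level_sum_rec[of j] algebra_simps)
qed

text \<open>Coefficient \<open>n\<close> at level \<open>j\<close> is determined by coefficient
  \<open>n\<close> at level \<open>j - 1\<close> and by coefficients below \<open>n\<close> at other
  levels, whence an induction on \<open>n\<close> and, inside it, on \<open>j\<close>.\<close>

lemma level_rec_unique:
  assumes "\<And>j. V j = (if j = 0 then 1 else V (j - 1)) -
     fps_X * fps_const (s ^ Suc j) * (fps_const c * V (j + k) + fps_const (p - c) * V j)"
  shows "V j = level_gf j"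
proof -
  have rec: "fps_nth (V j) n = fps_nth (level_gf j) n" if
     "j = 0 \<or> fps_nth (V (j - 1)) n = fps_nth (level_gf (j - 1)) n"
     "\<And>i l. l < n \<Longrightarrow> fps_nth (V i) l = fps_nth (level_gf i) l" for j n
    using that by (subst assms, subst level_gf_rec) (cases n; auto simp: mult.assoc)
  have "fps_nth (V j) n = fps_nth (level_gf j) n" for j n
  proof (induction n arbitrary: j rule: less_induct)
    case (less n)
    show ?case
      by (induction j) (rule rec; use less in simp)+
  qed
  then show ?thesis by (rule fps_ext)
qed

text \<open>The functional equation solved for the series, with \<open>p - c\<close> in the role of
  \<open>m - 1\<close>. Every occurrence of \<open>F\<close> carries a factor \<open>fps_X\<close>,
  which makes the operator contractive.\<close>

definition fun_eq_op :: "'a fps \<Rightarrow> 'a fps" where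
  "fun_eq_op F = 1 - fps_X * fps_const (s * (p - c)) * F -
     fps_X * fps_const (s * c) * (\<Prod>j=0..k. F oo (fps_X * fps_const (s ^ j)))"

lemma fun_eq_op_unique_fixpoint: "\<exists>!F. F = fun_eq_op F"
proof (rule fps_contraction_fixpoint)
  fix F G :: "'a fps" and n
  assume eq: "\<And>i. i < n \<Longrightarrow> fps_nth F i = fps_nth G i"
  show "fps_nth (fun_eq_op F) n = fps_nth (fun_eq_op G) n"
  proof (cases n)
    case (Suc l)
    have "fps_nth (\<Prod>j=0..k. F oo (fps_X * fps_const (s ^ j))) l =
          fps_nth (\<Prod>j=0..k. G oo (fps_X * fps_const (s ^ j))) l"
      by (rule fps_nth_prod_cong[of _ l]) (auto simp: fps_nth_compose_scaled_X eq Suc)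
    then show ?thesis
      by (simp add: fun_eq_op_def mult.assoc Suc eq)
  qed (simp add: fun_eq_op_def mult.assoc)
qed

lemma fixpoint_eq_level_gf:
  assumes F: "F = fun_eq_op F"
  shows "F = level_gf 0"
proof -
  define S where "S j = F oo (fps_X * fps_const (s ^ j))" for j
  define V where "V j = (\<Prod>i=0..j. S i)" for j
  have S_compose: "S i oo (fps_X * fps_const (s ^ j)) = S (i + j)" for i j
    by (simp add: S_def fps_compose_scaled_X_scaled_X power_add)
  \<comment> \<open>Substituting \<open>r s^j\<close> for \<open>r\<close> in the fixpoint equation
    shifts every index by \<open>j\<close>.\<close>
  have S_eq: "S j = 1 - fps_X * fps_const (s ^ Suc j) *
      (fps_const c * (\<Prod>i=0..k. S (i + j)) + fps_const (p - c) * S j)" for j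
  proof -
    have "S j = fun_eq_op F oo (fps_X * fps_const (s ^ j))"
      using F by (simp add: S_def)
    also have "\<dots> = 1 - fps_X * fps_const (s ^ j) * fps_const (s * (p - c)) * S j -
        fps_X * fps_const (s ^ j) * fps_const (s * c) * (\<Prod>i=0..k. S (i + j))"
      unfolding fun_eq_op_def S_def[symmetric]
      by (simp add: fps_compose_sub_distrib fps_compose_mult_distrib fps_compose_prod_distrib
          S_compose S_def[symmetric])
    also have "\<dots> = 1 - fps_X * fps_const (s ^ Suc j) *
      (fps_const c * (\<Prod>i=0..k. S (i + j)) + fps_const (p - c) * S j)"
      by (simp add: algebra_simps flip: fps_const_mult fps_const_sub)
    finally show ?thesis .
  qed
  have V_rec: "V j = (if j = 0 then 1 else V (j - 1)) -
     fps_X * fps_const (s ^ Suc j) * (fps_const c * V (j + k) + fps_const (p - c) * V j)" for j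
  proof -
    \<comment> \<open>Multiplying \<open>S_eq\<close> by \<open>Q\<close>, the product of the
      \<open>S i\<close> with \<open>i < j\<close>, turns \<open>S j\<close> into \<open>V j\<close>
      and the product of \<open>S j\<close> to \<open>S (j + k)\<close> into
      \<open>V (j + k)\<close>.\<close>
    define Q where "Q = (if j = 0 then 1 else V (j - 1))"
    have Q: "Q = (\<Prod>i<j. S i)"
      by (cases j) (auto simp: Q_def V_def lessThan_Suc_atMost atMost_atLeast0)
    have Vj: "V j = Q * S j"
      unfolding V_def Q atMost_atLeast0[symmetric] lessThan_Suc_atMost[symmetric] by simp
    have "V (j + k) = Q * (\<Prod>i=j..j + k. S i)"
      unfolding V_def Q atLeast0LessThan[symmetric] atLeastLessThanSuc_atLeastAtMost[symmetric]
      by (rule prod.atLeastLessThan_concat[symmetric]) auto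
    also have "(\<Prod>i=j..j + k. S i) = (\<Prod>i=0..k. S (i + j))"
      using prod.shift_bounds_cl_nat_ivl[of S 0 j k] by (simp add: add.commute)
    finally have Vjk: "V (j + k) = Q * (\<Prod>i=0..k. S (i + j))" .
    have "V j = Q * (1 - fps_X * fps_const (s ^ Suc j) *
      (fps_const c * (\<Prod>i=0..k. S (i + j)) + fps_const (p - c) * S j))"
      using Vj S_eq by metis
    also have "\<dots> = Q - fps_X * fps_const (s ^ Suc j) *
        (fps_const c * V (j + k) + fps_const (p - c) * V j)"
      unfolding Vjk Vj by (simp add: algebra_simps)
    finally show ?thesis unfolding Q_def .
  qed
  have "F = V 0"
    by (simp add: V_def S_def)
  also have "\<dots> = level_gf 0"
    using V_rec by (rule level_rec_unique)
  finally show ?thesis .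
qed

end

section \<open>The functional equation\<close>

lemma nu_equation_iff:
  "nu_equation k \<nu> \<longleftrightarrow>
     \<nu> = fun_eq_op k s_var (m_var * u_var) (m_var * (u_var - 1) + 1) \<nu>"
proof -
  have pc: "m_var * u_var - (m_var * (u_var - 1) + 1) = m_var - 1"
    by (simp add: algebra_simps)
  have rearrange: "(1 + x * y * a) * v = 1 - x * y * b * w \<longleftrightarrow> v = 1 - x * (y * a) * v - x * (y * b) * w"
    for x y a b v w :: "coef fps"
    by (auto simp: algebra_simps)
  show ?thesis
    unfolding nu_equation_def f_fun_def g_fun_def fun_eq_op_def pc fps_const_mult[symmetric]
    by (rule rearrange)
qed

lemma sum_Dyck_eq_level_sum:
  "(\<Sum>\<mu>\<in>Dyck n k. s_var ^ card (Y_boxes (lowest_path n k) \<mu>) * wtI n k \<mu>) =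
     level_sum k s_var (m_var * u_var) (m_var * (u_var - 1) + 1) 0 n"
  unfolding level_sum_def Dyck_eq_level_paths
proof (rule sum.cong)
  fix \<mu> assume \<mu>: "\<mu> \<in> level_paths k 0 n"
  have "m_prime * u_prime + u_prime + 1 = m_var * (u_var - 1) + 1"
    by (simp add: m_prime_def u_prime_def algebra_simps)
  then have "wtI n k \<mu> = path_weight k (m_var * u_var) (m_var * (u_var - 1) + 1) \<mu>"
    using \<mu> by (simp add: wtI_def path_weight_eq_powers level_paths_def m_prime_def u_prime_def
        power_mult_distrib)
  then show "s_var ^ card (Y_boxes (lowest_path n k) \<mu>) * wtI n k \<mu> =
      s_var ^ row_area k 0 \<mu> * path_weight k (m_var * u_var) (m_var * (u_var - 1) + 1) \<mu>"
    using card_Y_boxes[OF \<mu>] by simp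
qed simp

text \<open>Convergence is coefficientwise, and only the term \<open>n = i\<close> contributes to
  coefficient \<open>i\<close>, so the partial sums are constant there once
  \<open>N > i\<close>.\<close>

lemma fps_sums_scaled_X_powers:
  fixes a :: "'a::comm_ring_1"
  shows "(\<lambda>n. (- (fps_X * fps_const a)) ^ n * fps_const (b n)) sums
           Abs_fps (\<lambda>n. (- a) ^ n * b n)"
  unfolding sums_def
proof (rule tendsto_fpsI)
  fix i
  have pow: "(- (fps_X * fps_const a)) ^ n = fps_const ((- a) ^ n) * fps_X ^ n" for n
  proof -
    have "- (fps_X * fps_const a) = fps_const (- a) * fps_X"
      by (simp add: mult.commute flip: fps_const_neg)
    then show ?thesis
      by (simp only: power_mult_distrib fps_const_power)
  qed
  have nth: "fps_nth ((- (fps_X * fps_const a)) ^ n * fps_const (b n)) i =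
      (if i = n then (- a) ^ n * b n else 0)" for n
    by (simp add: pow)
  have "fps_nth (\<Sum>n<N. (- (fps_X * fps_const a)) ^ n * fps_const (b n)) i =
      fps_nth (Abs_fps (\<lambda>n. (- a) ^ n * b n)) i" if "N > i" for N
    unfolding fps_sum_nth nth using that by simp
  then show "eventually (\<lambda>N. fps_nth (\<Sum>n<N. (- (fps_X * fps_const a)) ^ n * fps_const (b n)) i =
      fps_nth (Abs_fps (\<lambda>n. (- a) ^ n * b n)) i) sequentially"
    using eventually_gt_at_top[of i] by (rule eventually_mono[rotated])
qed

theorem proposition4p17:
  fixes k :: nat
  assumes "k \<ge> 1"
  shows "(\<exists>!\<nu>. nu_equation k \<nu>) \<and>
         (\<forall>\<nu>. nu_equation k \<nu> \<longrightarrow>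
           (\<lambda>n. (- (fps_X * fps_const s_var)) ^ n *
                 fps_const (\<Sum>\<mu>\<in>Dyck n k.
                   s_var ^ card (Y_boxes (lowest_path n k) \<mu>) * wtI n k \<mu>)) sums \<nu>)"
proof (intro conjI allI impI)
  show "\<exists>!\<nu>. nu_equation k \<nu>"
    unfolding nu_equation_iff by (rule fun_eq_op_unique_fixpoint)
next
  fix \<nu> assume "nu_equation k \<nu>"
  then have "\<nu> = level_gf k s_var (m_var * u_var) (m_var * (u_var - 1) + 1) 0"
    unfolding nu_equation_iff by (rule fixpoint_eq_level_gf)
  then show "(\<lambda>n. (- (fps_X * fps_const s_var)) ^ n *
                 fps_const (\<Sum>\<mu>\<in>Dyck n k.
                   s_var ^ card (Y_boxes (lowest_path n k) \<mu>) * wtI n k \<mu>)) sums \<nu>"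
    unfolding sum_Dyck_eq_level_sum level_gf_def by (simp add: fps_sums_scaled_X_powers)
qed

end
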